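(* Let $d=\frac{1-\sqrt{3}}{2}+i\left(\frac{\sqrt{3}}{2}\right)^{1/2}$, which has absolute value $1$, let $$C_6^{(0)}= \begin{pmatrix} 1 & 1 & 1 & 1 & 1 & 1 \\ 1 & -1 & -d & -d^2 & d^2 & d \\ 1 & -\bar{d} & 1 & d^2 & -d^3 & d^2 \\ 1 & -\bar{d}^2 & \bar{d}^2 & -1 & d^2 & -d^2 \\ 1 & \bar{d}^2 & -\bar{d}^3 & \bar{d}^2 & 1 & -d \\ 1 & \bar{d} & \bar{d}^2 & -\bar{d}^2 & -\bar{d} & -1 \end{pmatrix},$$ and let $\theta_0=2\operatorname{Arg}(d)$. Then $H(\theta_0)$ is equivalent to $C_6^{(0)}$. Indeed, $P H(\theta_0) P^{-1}= C_6^{(0)}$, where $P$ is the permutation matrix $$P=\begin{pmatrix} 1 & 0 & 0 & 0 & 0 & 0 \\ 0 & 1 & 0 & 0 & 0 & 0 \\ 0 & 0 & 0 & 0 & 1 & 0 \\ 0 & 0 & 0 & 1 & 0 & 0 \\ 0 & 0 & 0 & 0 & 0 & 1 \\ 0 & 0 & 1 & 0 & 0 & 0 \end{pmatrix}.$$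
   Context: For real $\theta$, define $$H(\theta)=\begin{pmatrix} 1 & 1 & 1 & 1 & 1 & 1 \\ 1 & -1 & \bar{x} &-y &-\bar{x} &y \\ 1 & x & -1 & t & -t & -x \\ 1 &-\bar{y} & \bar{t} & -1 & \bar{y} &-\bar{t} \\ 1 &-x & -\bar{t} & y & 1 &\bar{z} \\ 1 & \bar{y} &-\bar{x} &-t & z & 1 \end{pmatrix}$$ where $y=\exp(i\theta)$, $z=\frac{1+2y-y^2}{y(-1+2y+y^2)}$, $x=\frac{1+2y+y^2-\sqrt{2}\sqrt{1+2y+2y^3+y^4}}{1+2y-y^2}$, $t=\frac{1+2y+y^2-\sqrt{2}\sqrt{1+2y+2y^3+y^4}}{-1+2y+y^2}$. The square root of a complex number denotes the principal value of $w\mapsto w^{1/2}$ (argument of $w$ taken in $(-\pi,\pi]$). $H(\theta)$ depends only on $e^{i\theta}$, so $\theta_0$ matters only modulo $2\pi$. A complex Hadamard matrix of order $n$ is a matrix in $M_n(\mathbb C)$ all of whose entries have absolute value $1$ and which becomes unitary after multiplication by $\frac{1}{\sqrt n}$. Two complex Hadamard matrices $H_1,H_2$ are equivalent if there exist unitary diagonal matrices $D_1,D_2$ and permutation matrices $P_1,P_2$ with $H_2=P_1D_1H_1D_2P_2$. *)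

theory Defs
  imports "HOL-Analysis.Analysis"
begin

subsection \<open>Complex Hadamard matrices and their equivalence\<close>

definition adjoint_matrix :: "complex^'n^'m \<Rightarrow> complex^'m^'n" where
  "adjoint_matrix A = map_matrix cnj (transpose A)"

definition unitary_matrix :: "complex^'n^'n \<Rightarrow> bool" where
  "unitary_matrix U \<longleftrightarrow> U ** adjoint_matrix U = mat 1 \<and> adjoint_matrix U ** U = mat 1"

definition diagonal_matrix :: "complex^'n^'n \<Rightarrow> bool" where
  "diagonal_matrix D \<longleftrightarrow> (\<forall>i j. i \<noteq> j \<longrightarrow> D $ i $ j = 0)"

definition permutation_matrix :: "complex^'n^'n \<Rightarrow> bool" where
  "permutation_matrix P \<longleftrightarrow>
     (\<exists>\<pi>. \<pi> permutes UNIV \<and> P = (\<chi> i j. if j = \<pi> i then 1 else 0))"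

definition complex_Hadamard :: "complex^'n^'n \<Rightarrow> bool" where
  "complex_Hadamard H \<longleftrightarrow>
     (\<forall>i j. cmod (H $ i $ j) = 1) \<and>
     unitary_matrix ((1 / sqrt (real CARD('n))) *\<^sub>R H)"

text \<open>Equivalence is a relation between complex Hadamard matrices, so both arguments are
  required to be Hadamard.\<close>

definition Hadamard_equivalent :: "complex^'n^'n \<Rightarrow> complex^'n^'n \<Rightarrow> bool" where
  "Hadamard_equivalent H1 H2 \<longleftrightarrow>
     complex_Hadamard H1 \<and> complex_Hadamard H2 \<and>
     (\<exists>P1 D1 D2 P2.
        permutation_matrix P1 \<and> permutation_matrix P2 \<and>
        diagonal_matrix D1 \<and> unitary_matrix D1 \<and>
        diagonal_matrix D2 \<and> unitary_matrix D2 \<and>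
        H2 = P1 ** D1 ** H1 ** D2 ** P2)"

subsection \<open>The matrices of order 6\<close>

text \<open>Rows and columns are indexed by the type \<open>6\<close>, in which \<open>6 = 0\<close>; the following
  analogue of the library's \<open>vector_4\<close> confirms that the list notation numbers the
  entries 1, ..., 6.\<close>

lemma vector_6:
  fixes a b c d e f :: "'a::zero"
  shows "(vector [a, b, c, d, e, f] :: 'a^6) $ 1 = a"
    and "(vector [a, b, c, d, e, f] :: 'a^6) $ 2 = b"
    and "(vector [a, b, c, d, e, f] :: 'a^6) $ 3 = c"
    and "(vector [a, b, c, d, e, f] :: 'a^6) $ 4 = d"
    and "(vector [a, b, c, d, e, f] :: 'a^6) $ 5 = e"
    and "(vector [a, b, c, d, e, f] :: 'a^6) $ 6 = f"
  unfolding vector_def by simp_all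

definition H_y :: "real \<Rightarrow> complex" where
  "H_y \<theta> = exp (\<i> * of_real \<theta>)"

definition H_z :: "real \<Rightarrow> complex" where
  "H_z \<theta> = (let y = H_y \<theta> in (1 + 2*y - y^2) / (y * (- 1 + 2*y + y^2)))"

definition H_x :: "real \<Rightarrow> complex" where
  "H_x \<theta> = (let y = H_y \<theta> in
     (1 + 2*y + y^2 - of_real (sqrt 2) * csqrt (1 + 2*y + 2*y^3 + y^4)) / (1 + 2*y - y^2))"

definition H_t :: "real \<Rightarrow> complex" where
  "H_t \<theta> = (let y = H_y \<theta> in
     (1 + 2*y + y^2 - of_real (sqrt 2) * csqrt (1 + 2*y + 2*y^3 + y^4)) / (- 1 + 2*y + y^2))"

definition H_matrix :: "real \<Rightarrow> complex^6^6" where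
  "H_matrix \<theta> = (let x = H_x \<theta>; y = H_y \<theta>; z = H_z \<theta>; t = H_t \<theta> in
     vector [
       vector [1,  1,      1,      1,  1,      1],
       vector [1, -1,      cnj x, -y, -cnj x,  y],
       vector [1,  x,     -1,      t, -t,     -x],
       vector [1, -cnj y,  cnj t, -1,  cnj y, -cnj t],
       vector [1, -x,     -cnj t,  y,  1,      cnj z],
       vector [1,  cnj y, -cnj x, -t,  z,      1]])"

definition d_const :: complex where
  "d_const = of_real ((1 - sqrt 3) / 2) + \<i> * of_real (sqrt (sqrt 3 / 2))"

definition C6_0 :: "complex^6^6" where
  "C6_0 = (let d = d_const in
     vector [
       vector [1,  1,           1,           1,           1,      1],
       vector [1, -1,          -d,          -(d^2),       d^2,    d],
       vector [1, -cnj d,       1,           d^2,        -(d^3),  d^2],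
       vector [1, -(cnj d ^ 2), cnj d ^ 2,  -1,           d^2,   -(d^2)],
       vector [1,  cnj d ^ 2,  -(cnj d ^ 3), cnj d ^ 2,   1,     -d],
       vector [1,  cnj d,       cnj d ^ 2,  -(cnj d ^ 2), -cnj d, -1]])"

definition theta0 :: real where
  "theta0 = 2 * Arg d_const"

definition P_matrix :: "complex^6^6" where
  "P_matrix = vector [
       vector [1, 0, 0, 0, 0, 0],
       vector [0, 1, 0, 0, 0, 0],
       vector [0, 0, 0, 0, 1, 0],
       vector [0, 0, 0, 1, 0, 0],
       vector [0, 0, 0, 0, 0, 1],
       vector [0, 0, 1, 0, 0, 0]]"

end

theory Submission
  imports Defs
begin

text \<open>
  Write \<open>e = cnj d\<close>.  Since \<open>u = d + e = 1 - sqrt 3\<close> is a root of \<open>u^2 = 2u + 2\<close>, the number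
  \<open>d\<close> is governed by the two relations \<open>d * e = 1\<close> and \<open>d^2 + e^2 = 2 * (d + e)\<close>.
  Both halves of the theorem are polynomial consequences of these, except for one sign.

  The conjugation asks that \<open>x = e\<close>, \<open>y = d^2\<close>, \<open>z = - e^3\<close> and \<open>t = - e^2\<close> at \<open>\<theta>\<^sub>0\<close>.  The value of
  \<open>y\<close> is the choice of \<open>\<theta>\<^sub>0\<close>.  The relations give \<open>1 + 2y - y^2 = - e * (- 1 + 2y + y^2)\<close>, hence \<open>z\<close>;
  they also give a square root of \<open>2 * (1 + 2y + 2y^3 + y^4)\<close>, namely
  \<open>y * (d^2 - e^2 + 2 * (d - e))\<close>, and with it \<open>x\<close> and \<open>t\<close>.  It remains to see
  that this is \<open>sqrt 2\<close> times the principal root (\<open>csqrt_at_theta0\<close>): the second factor is \<open>\<i>\<close>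
  times a positive number, and \<open>Im y < 0\<close>, so the real part is positive.

  Equivalence includes the assertion that both matrices are Hadamard.  For \<open>C\<^sub>6\<close> this is
  the vanishing of the inner products of distinct rows, polynomials in \<open>d\<close> and \<open>e\<close> that the relations
  annihilate (\<open>complex_Hadamard_C6_0\<close>); the property passes to \<open>H(\<theta>\<^sub>0)\<close> because conjugation by a
  permutation matrix only permutes rows and columns.
\<close>

section \<open>The type of six indices\<close>

lemma exhaust_6:
  fixes x :: 6
  shows "x = 1 \<or> x = 2 \<or> x = 3 \<or> x = 4 \<or> x = 5 \<or> x = 6"
proof (induct x)
  case (of_int z)
  then have "z = 0 \<or> z = 1 \<or> z = 2 \<or> z = 3 \<or> z = 4 \<or> z = 5" by fastforce
  then show ?case by auto
qed

lemma forall_6: "(\<forall>i::6. P i) \<longleftrightarrow> P 1 \<and> P 2 \<and> P 3 \<and> P 4 \<and> P 5 \<and> P 6"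
  by (metis exhaust_6)

lemma UNIV_6: "(UNIV :: 6 set) = {1, 2, 3, 4, 5, 6}"
  using exhaust_6 by auto

lemma sum_6: "sum f (UNIV :: 6 set) = f 1 + f 2 + f 3 + f 4 + f 5 + f 6"
  unfolding UNIV_6 by (simp add: ac_simps)

section \<open>Row orthogonality and simultaneous permutations\<close>

text \<open>Only one of the two unitarity equations is reflected here, because a one-sided inverse
  of a square matrix is two-sided; the diagonal entries of that equation hold as soon as all
  entries are unimodular.\<close>

lemma complex_Hadamard_iff:
  fixes H :: "complex^'n^'n"
  shows "complex_Hadamard H \<longleftrightarrow>
    (\<forall>i j. cmod (H $ i $ j) = 1) \<and>
    (\<forall>i j. i \<noteq> j \<longrightarrow> (\<Sum>k\<in>UNIV. H $ i $ k * cnj (H $ j $ k)) = 0)"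
proof (cases "\<forall>i j. cmod (H $ i $ j) = 1")
  case True
  define U where "U = (1 / sqrt (real CARD('n))) *\<^sub>R H"
  have pos: "real CARD('n) > 0" by simp
  have entry: "(U ** adjoint_matrix U) $ i $ j
      = (\<Sum>k\<in>UNIV. H $ i $ k * cnj (H $ j $ k)) / of_nat CARD('n)" for i j
  proof -
    define c where "c = 1 / sqrt (real CARD('n))"
    have c: "of_real c * of_real c = (1 / of_nat CARD('n) :: complex)"
      using pos by (simp add: c_def flip: of_real_mult)
    have "U $ a $ b = of_real c * H $ a $ b" for a b
      unfolding U_def c_def[symmetric] vector_scaleR_component by (simp add: scaleR_conv_of_real)
    then have "(U ** adjoint_matrix U) $ i $ j
        = (\<Sum>k\<in>UNIV. of_real c * of_real c * (H $ i $ k * cnj (H $ j $ k)))"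
      by (simp add: matrix_matrix_mult_def adjoint_matrix_def map_matrix_def transpose_def mult_ac)
    then show ?thesis unfolding c by (simp add: sum_divide_distrib)
  qed
  have diag: "(\<Sum>k\<in>UNIV. H $ i $ k * cnj (H $ i $ k)) = of_nat CARD('n)" for i
    using True by (simp add: complex_norm_square[symmetric])
  have "unitary_matrix U \<longleftrightarrow> U ** adjoint_matrix U = mat 1"
    unfolding unitary_matrix_def using matrix_left_right_inverse by blast
  also have "\<dots> \<longleftrightarrow> (\<forall>i j. i \<noteq> j \<longrightarrow> (\<Sum>k\<in>UNIV. H $ i $ k * cnj (H $ j $ k)) = 0)"
    unfolding vec_eq_iff entry mat_def using diag by auto
  finally show ?thesis
    using True by (simp add: complex_Hadamard_def U_def)
next
  case False
  then show ?thesis unfolding complex_Hadamard_def by blast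
qed

lemma complex_Hadamard_reindex:
  fixes H :: "complex^'n^'n"
  assumes "complex_Hadamard H" and "\<pi> permutes UNIV"
  shows "complex_Hadamard (\<chi> i j. H $ \<pi> i $ \<pi> j)"
proof -
  have "(\<Sum>k\<in>UNIV. H $ \<pi> i $ \<pi> k * cnj (H $ \<pi> j $ \<pi> k))
      = (\<Sum>k\<in>UNIV. H $ \<pi> i $ k * cnj (H $ \<pi> j $ k))" for i j
    using sum.permute[OF assms(2), of "\<lambda>k. H $ \<pi> i $ k * cnj (H $ \<pi> j $ k)"]
    by (simp add: o_def)
  then show ?thesis
    using assms permutes_inj[OF assms(2)] by (simp add: complex_Hadamard_iff inj_eq)
qed

lemma matrix_inv_unique:
  fixes A B :: "'a::field^'n^'n"
  assumes "A ** B = mat 1"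
  shows "matrix_inv A = B"
proof -
  have BA: "B ** A = mat 1" using assms matrix_left_right_inverse by blast
  have "A ** matrix_inv A = mat 1 \<and> matrix_inv A ** A = mat 1"
    unfolding matrix_inv_def by (rule someI[of _ B]) (use assms BA in simp)
  then have "B = B ** (A ** matrix_inv A)" by simp
  also have "\<dots> = matrix_inv A" by (simp only: matrix_mul_assoc BA matrix_mul_lid)
  finally show ?thesis by simp
qed

lemma permutation_matrix_inverse:
  fixes \<pi> :: "'n::finite \<Rightarrow> 'n"
  assumes "\<pi> permutes UNIV"
  shows "matrix_inv (\<chi> i j. if j = \<pi> i then 1 else (0::complex))
    = (\<chi> i j. if j = inv \<pi> i then 1 else 0)"
proof (rule matrix_inv_unique)
  have "j = inv \<pi> k \<longleftrightarrow> k = \<pi> j" for j k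
    using permutes_inverses[OF assms] by auto
  moreover have "\<pi> i = \<pi> j \<longleftrightarrow> i = j" for i j
    using permutes_inj[OF assms] by (simp add: inj_eq)
  moreover have "(if b then 1 else 0) * c = (if b then c else 0)" for b and c :: complex
    by simp
  ultimately show "(\<chi> i j. if j = \<pi> i then 1 else (0::complex))
      ** (\<chi> i j. if j = inv \<pi> i then 1 else 0) = mat 1"
    by (simp add: vec_eq_iff matrix_matrix_mult_def mat_def)
qed

lemma permutation_matrix_conjugate:
  fixes A :: "complex^'n^'n"
  assumes "\<pi> permutes UNIV" and "P = (\<chi> i j. if j = \<pi> i then 1 else 0)"
  shows "P ** A ** matrix_inv P = (\<chi> i j. A $ \<pi> i $ \<pi> j)"
proof -
  have inv: "j = inv \<pi> k \<longleftrightarrow> k = \<pi> j" for j k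
    using permutes_inverses[OF assms(1)] by auto
  show ?thesis
    unfolding assms(2) permutation_matrix_inverse[OF assms(1)]
    by (simp add: vec_eq_iff matrix_matrix_mult_def inv if_distrib if_distribR cong: if_cong)
qed

text \<open>That \<open>H\<close> itself is Hadamard comes from the conjugate by permuting back, so the
  orthogonality of rows has to be computed for only one of the two matrices.\<close>

lemma Hadamard_equivalent_permutation_conjugate:
  fixes H :: "complex^'n^'n"
  assumes "complex_Hadamard (P ** H ** matrix_inv P)" and "permutation_matrix P"
  shows "Hadamard_equivalent H (P ** H ** matrix_inv P)"
proof -
  obtain \<pi> where \<pi>: "\<pi> permutes UNIV" "P = (\<chi> i j. if j = \<pi> i then 1 else 0)"
    using assms(2) by (auto simp: permutation_matrix_def)
  note \<pi>' = permutes_inv[OF \<pi>(1)]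
  have "H = (\<chi> i j. (P ** H ** matrix_inv P) $ inv \<pi> i $ inv \<pi> j)"
    unfolding permutation_matrix_conjugate[OF \<pi>]
    using permutes_inverses[OF \<pi>(1)] by (simp add: vec_eq_iff)
  then have "complex_Hadamard H"
    using complex_Hadamard_reindex[OF assms(1) \<pi>'] by simp
  moreover have "permutation_matrix (matrix_inv P)"
    unfolding \<pi>(2) permutation_matrix_inverse[OF \<pi>(1)] permutation_matrix_def
    using \<pi>' by blast
  moreover have "diagonal_matrix (mat 1 :: complex^'n^'n)"
    by (simp add: diagonal_matrix_def mat_def)
  moreover have "unitary_matrix (mat 1 :: complex^'n^'n)"
  proof -
    have "adjoint_matrix (mat 1 :: complex^'n^'n) = mat 1"
      by (simp add: adjoint_matrix_def map_matrix_def transpose_def mat_def vec_eq_iff)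
    then show ?thesis by (simp add: unitary_matrix_def)
  qed
  moreover have "P ** H ** matrix_inv P = P ** mat 1 ** H ** mat 1 ** matrix_inv P"
    by simp
  ultimately show ?thesis
    unfolding Hadamard_equivalent_def using assms by blast
qed

section \<open>The unimodular number d\<close>

lemma Re_d: "Re d_const = (1 - sqrt 3) / 2" and Im_d: "Im d_const = sqrt (sqrt 3 / 2)"
  by (simp_all add: d_const_def)

lemma norm_d: "cmod d_const = 1"
proof -
  have "(cmod d_const)\<^sup>2 = 1"
    unfolding cmod_power2 Re_d Im_d by (simp add: power2_eq_square field_simps)
  then show ?thesis using norm_ge_zero[of d_const] by (auto simp: power2_eq_1_iff)
qed

lemma d_mult_cnj: "d_const * cnj d_const = 1"
  using norm_d by (simp add: complex_norm_square[symmetric])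

lemma d_add_cnj: "d_const + cnj d_const = of_real (1 - sqrt 3)"
  by (simp add: complex_add_cnj Re_d)

lemma d_diff_cnj: "d_const - cnj d_const = 2 * \<i> * of_real (sqrt (sqrt 3 / 2))"
  by (simp add: complex_diff_cnj Im_d mult_ac)

text \<open>This is the quadratic equation of \<open>1 - sqrt 3\<close>, rewritten with \<open>d * cnj d = 1\<close> so that square
  roots of reals disappear from all later computations with \<open>d\<close>.\<close>

lemma d_relation: "d_const^2 + cnj d_const^2 = 2 * (d_const + cnj d_const)"
proof -
  have "(of_real (1 - sqrt 3) :: complex)^2 = of_real ((1 - sqrt 3)^2)" by simp
  also have "(1 - sqrt 3)^2 = 2 * (1 - sqrt 3) + 2"
    by (simp add: power2_eq_square algebra_simps)
  finally have "(d_const + cnj d_const)^2 = 2 * (d_const + cnj d_const) + 2"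
    unfolding d_add_cnj by simp
  then show ?thesis using d_mult_cnj by algebra
qed

text \<open>Each inner product of two distinct rows lies in the ideal generated by \<open>d * e - 1\<close> and
  \<open>d^2 + e^2 - 2 * (d + e)\<close>, so a Groebner basis computation shows that it vanishes.\<close>

lemma complex_Hadamard_C6_0: "complex_Hadamard C6_0"
proof -
  define d e where "d = d_const" and "e = cnj d_const"
  have cnj: "cnj d = e" "cnj e = d" and norm: "cmod d = 1" "cmod e = 1"
    using norm_d by (simp_all add: d_def e_def)
  have rel: "d * e = 1" "d^2 + e^2 = 2 * (d + e)"
    using d_mult_cnj d_relation by (simp_all add: d_def e_def)
  show ?thesis
    unfolding complex_Hadamard_iff forall_6 sum_6 C6_0_def Let_def vector_6
      d_def[symmetric] cnj
    by (simp add: norm norm_mult norm_power cnj; intro conjI; insert rel; algebra)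
qed

section \<open>The parameters at theta0\<close>

lemma H_y_theta0: "H_y theta0 = d_const^2"
proof -
  have "d_const = exp (\<i> * of_real (Arg d_const))"
    using Arg_eq[of d_const] norm_d by force
  then have "d_const^2 = exp (\<i> * of_real (Arg d_const))^2" by simp
  then show ?thesis
    by (simp add: H_y_def theta0_def exp_double[symmetric] mult_ac)
qed

text \<open>After division by \<open>y\<close> both quantities become \<open>2\<close> plus a purely imaginary number.\<close>

lemma unimodular_denominators:
  assumes "cmod y = 1"
  shows "1 + 2 * y - y^2 \<noteq> 0" and "- 1 + 2 * y + y^2 \<noteq> 0"
proof -
  have yc: "y * cnj y = 1" using assms by (simp add: complex_norm_square[symmetric])
  have "y \<noteq> 0" using assms by auto
  have eq: "1 + 2 * y - y^2 = y * (2 + (cnj y - y))" "- 1 + 2 * y + y^2 = y * (2 + (y - cnj y))"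
    using yc by (simp_all add: algebra_simps power2_eq_square)
  have "Re (2 + (cnj y - y)) \<noteq> 0" "Re (2 + (y - cnj y)) \<noteq> 0" by simp_all
  then have "2 + (cnj y - y) \<noteq> 0" "2 + (y - cnj y) \<noteq> 0" by (metis zero_complex.simps(1))+
  then show "1 + 2 * y - y^2 \<noteq> 0" "- 1 + 2 * y + y^2 \<noteq> 0"
    unfolding eq using \<open>y \<noteq> 0\<close> by simp_all
qed

text \<open>The squares agree by the relations for \<open>d\<close>; the branch is decided by
  \<open>Re (\<i> * y) = - Im y > 0\<close>.\<close>

lemma csqrt_at_theta0:
  fixes y :: complex
  defines "y \<equiv> d_const^2"
  shows "of_real (sqrt 2) * csqrt (1 + 2 * y + 2 * y^3 + y^4)
    = y * (d_const^2 - cnj d_const^2 + 2 * (d_const - cnj d_const))"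
proof -
  define r where "r = sqrt (sqrt 3 / 2)"
  define k where "k = sqrt 3 * (sqrt 3 - 1) * r"
  define w where "w = of_real (sqrt 2 * k) * (\<i> * y)"
  have "k > 0" "r > 0" by (simp_all add: k_def r_def)
  have root2: "(of_real (sqrt 2) :: complex)^2 = 2"
    by (simp flip: of_real_power)
  have diff: "d_const^2 - cnj d_const^2 + 2 * (d_const - cnj d_const) = 2 * \<i> * of_real k"
  proof -
    have "d_const^2 - cnj d_const^2 + 2 * (d_const - cnj d_const)
        = (d_const - cnj d_const) * (d_const + cnj d_const + 2)"
      by algebra
    also have "\<dots> = 2 * \<i> * of_real (r * (3 - sqrt 3))"
      unfolding d_add_cnj d_diff_cnj r_def by simp
    also have "r * (3 - sqrt 3) = k" by (simp add: k_def algebra_simps)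
    finally show ?thesis .
  qed
  have w: "of_real (sqrt 2) * w = y * (d_const^2 - cnj d_const^2 + 2 * (d_const - cnj d_const))"
    unfolding diff w_def using root2 by (simp add: power2_eq_square)
  have "csqrt (1 + 2 * y + 2 * y^3 + y^4) = w"
  proof (rule csqrt_unique)
    have "2 * w^2 = (y * (d_const^2 - cnj d_const^2 + 2 * (d_const - cnj d_const)))^2"
      unfolding w[symmetric] power_mult_distrib root2 ..
    then have "2 * w^2 = 2 * (1 + 2 * y + 2 * y^3 + y^4)"
      using d_relation d_mult_cnj unfolding y_def by algebra
    then show "w^2 = 1 + 2 * y + 2 * y^3 + y^4" by (metis mult_cancel_left zero_neq_numeral)
    have "Im y = (1 - sqrt 3) * r"
      by (simp add: y_def Im_power2 Re_d Im_d r_def)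
    then have "Im y < 0" using \<open>r > 0\<close> by (simp add: mult_less_0_iff)
    then show "0 < Re w \<or> Re w = 0 \<and> 0 \<le> Im w"
      using \<open>k > 0\<close> by (simp add: w_def mult_less_0_iff zero_less_mult_iff)
  qed
  with w show ?thesis by simp
qed

lemma H_parameters_theta0:
  shows "H_x theta0 = cnj d_const" and "H_t theta0 = - (cnj d_const^2)"
    and "H_z theta0 = - (cnj d_const^3)"
proof -
  define d e where "d = d_const" and "e = cnj d_const"
  have rel: "d * e = 1" "d^2 + e^2 = 2 * (d + e)"
    using d_mult_cnj d_relation by (simp_all add: d_def e_def)
  have "cmod (d^2) = 1" using norm_d by (simp add: d_def norm_power)
  note den = unimodular_denominators[OF this]
  have "d \<noteq> 0" using rel by auto
  then have inv_d: "e = 1 / d" using rel(1) by (simp add: field_simps)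
  have numerator: "1 + 2 * d^2 + (d^2)^2 - d^2 * (d^2 - e^2 + 2 * (d - e)) = e * (1 + 2 * d^2 - (d^2)^2)"
    using rel by algebra
  have ratio: "1 + 2 * d^2 - (d^2)^2 = - e * (- 1 + 2 * d^2 + (d^2)^2)"
    using rel by algebra
  note sqrt = csqrt_at_theta0[folded d_def e_def]
  show "H_x theta0 = cnj d_const"
    unfolding e_def[symmetric]
    unfolding H_x_def H_y_theta0 Let_def d_def[symmetric] sqrt numerator using den by simp
  show "H_t theta0 = - (cnj d_const^2)"
    unfolding e_def[symmetric]
    unfolding H_t_def H_y_theta0 Let_def d_def[symmetric] sqrt numerator
    unfolding ratio using den by (simp add: power2_eq_square)
  show "H_z theta0 = - (cnj d_const^3)"
    unfolding e_def[symmetric]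
    unfolding H_z_def H_y_theta0 Let_def d_def[symmetric] ratio
    using den inv_d \<open>d \<noteq> 0\<close> by (simp add: power_divide eval_nat_numeral)
qed

section \<open>The permutation\<close>

definition \<sigma> :: "6 \<Rightarrow> 6" where
  "\<sigma> i = vector [1, 2, 5, 4, 6, 3] $ i"

lemma \<sigma>_simps: "\<sigma> 1 = 1" "\<sigma> 2 = 2" "\<sigma> 3 = 5" "\<sigma> 4 = 4" "\<sigma> 5 = 6" "\<sigma> 6 = 3"
  by (simp_all only: \<sigma>_def vector_6)

lemma \<sigma>_permutes: "\<sigma> permutes UNIV"
proof -
  have "surj \<sigma>"
    unfolding surj_def forall_6 using \<sigma>_simps by metis
  then have "bij \<sigma>"
    using finite_UNIV_surj_inj[of \<sigma>] by (simp add: bij_def)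
  then show ?thesis by (rule bij_imp_permutes) simp
qed

lemma P_matrix_eq: "P_matrix = (\<chi> i j. if j = \<sigma> i then 1 else 0)"
  unfolding vec_eq_iff forall_6 by (simp add: P_matrix_def vector_6 \<sigma>_simps)

lemma H_matrix_reindex: "(\<chi> i j. H_matrix theta0 $ \<sigma> i $ \<sigma> j) = C6_0"
  unfolding vec_eq_iff forall_6
  by (simp add: \<sigma>_simps vector_6 H_matrix_def C6_0_def Let_def H_parameters_theta0 H_y_theta0)

theorem mainTheorem2:
  shows "cmod d_const = 1
    \<and> Hadamard_equivalent (H_matrix theta0) C6_0
    \<and> permutation_matrix P_matrix
    \<and> P_matrix ** H_matrix theta0 ** matrix_inv P_matrix = C6_0"
proof -
  have P: "permutation_matrix P_matrix"
    unfolding permutation_matrix_def using \<sigma>_permutes P_matrix_eq by blast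
  have conj: "P_matrix ** H_matrix theta0 ** matrix_inv P_matrix = C6_0"
    unfolding permutation_matrix_conjugate[OF \<sigma>_permutes P_matrix_eq] by (rule H_matrix_reindex)
  have "Hadamard_equivalent (H_matrix theta0) C6_0"
    using Hadamard_equivalent_permutation_conjugate[of P_matrix "H_matrix theta0"]
      complex_Hadamard_C6_0 P conj by simp
  with norm_d P conj show ?thesis by simp
qed

end
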